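(* Let $p$ be a prime, let $r,v_1,\ldots,v_r \in \mathbb{Z}^+$, and put $G = \bigoplus_{i=1}^r \mathbb{Z}/p^{v_i}\mathbb{Z}$. For $n \in \mathbb{Z}^+$, let $x = (x_1,\ldots,x_n) \in G^n$ be a sequence of elements of $G$. Let $A_1,\ldots,A_n$ be nonempty subsets of $\mathbb{Z}$ such that for each $i$ the elements of $A_i$ are pairwise incongruent modulo $p$, and put $A = \prod_{i=1}^n A_i$. For $g \in G$, let \[ N_{g,A}(x) = \# \{a = (a_1,\ldots,a_n) \in A \mid a_1 x_1 + \ldots + a_n x_n = g \}. \] Then $N_{g,A}(x) = 0$ or \[ N_{g,A}(x) \geq \mathfrak{m} \Big( \# A_1,\ldots,\# A_n;\ \# A_1 + \ldots + \# A_n - \sum_{i=1}^r (p^{v_i}-1) \Big). \]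
   Context: Definition of $\mathfrak{m}$. Let $a_1,\ldots,a_n \geq 1$ be integers. For an integer $N$ with $n \leq N \leq a_1+\ldots+a_n$, a distribution of $N$ balls is an $n$-tuple of integers $y = (y_1,\ldots,y_n)$ with $1 \leq y_i \leq a_i$ for all $i$ and $y_1+\ldots+y_n = N$; put $P(y) = y_1 \cdots y_n$. Then $\mathfrak{m}(a_1,\ldots,a_n;N)$ is the minimum of $P(y)$ over all such distributions. For integers $N < n$ put $\mathfrak{m}(a_1,\ldots,a_n;N) = 1$, and for integers $N > a_1+\ldots+a_n$ put $\mathfrak{m}(a_1,\ldots,a_n;N) = a_1\cdots a_n$. (The value does not depend on the order of $a_1,\ldots,a_n$.) *)

theory Defs
  imports "HOL-Algebra.Product_Groups" "HOL-Algebra.FiniteProduct" "HOL-Number_Theory.Cong"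
begin

definition distributions :: "nat \<Rightarrow> (nat \<Rightarrow> nat) \<Rightarrow> int \<Rightarrow> (nat \<Rightarrow> nat) set" where
  "distributions n a N = {y \<in> \<Pi>\<^sub>E i\<in>{1..n}. {1..a i}. int (\<Sum>i=1..n. y i) = N}"

text \<open>
  The tuple \<open>(a\<^sub>1, \<dots>, a\<^sub>n)\<close> is the restriction of \<open>a\<close> to \<open>{1..n}\<close>, with all
  entries \<open>\<ge> 1\<close>. The argument \<open>N\<close> is an integer and may be negative. The lemmas
  below show that the minimum is taken over a finite nonempty set.
\<close>

definition min_dist :: "nat \<Rightarrow> (nat \<Rightarrow> nat) \<Rightarrow> int \<Rightarrow> nat" where
  "min_dist n a N =
     (if N < int n then 1
      else if N > int (\<Sum>i=1..n. a i) then \<Prod>i=1..n. a i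
      else Min ((\<lambda>y. \<Prod>i=1..n. y i) ` distributions n a N))"

lemma finite_distributions: "finite (distributions n a N)"
  unfolding distributions_def
  by (rule finite_subset[OF _ finite_PiE[of "{1..n}" "\<lambda>i. {1..a i}"]]) auto

lemma distributions_nonempty:
  assumes "\<forall>i\<in>{1..n}. 1 \<le> a i" "int n \<le> N" "N \<le> int (\<Sum>i=1..n. a i)"
  shows "distributions n a N \<noteq> {}"
proof -
  have "\<exists>y. (\<forall>i\<in>{1..n}. 1 \<le> y i \<and> y i \<le> a i) \<and> (\<Sum>i=1..n. y i) = M"
    if "\<forall>i\<in>{1..n}. 1 \<le> a i" "n \<le> M" "M \<le> (\<Sum>i=1..n. a i)" for M
    using that
  proof (induction n arbitrary: M)
    case 0
    then show ?case by simp
  next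
    case (Suc n)
    define k where "k = min (a (Suc n)) (M - n)"
    have a: "\<forall>i\<in>{1..n}. 1 \<le> a i" "1 \<le> a (Suc n)"
      using Suc.prems by auto
    have "n \<le> (\<Sum>i=1..n. a i)"
      using sum_mono[of "{1..n}" "\<lambda>_. 1" a] a by simp
    then have k: "1 \<le> k" "k \<le> a (Suc n)" "k \<le> M" "n \<le> M - k" "M - k \<le> (\<Sum>i=1..n. a i)"
      using Suc.prems a by (auto simp: k_def)
    then obtain y where y: "\<forall>i\<in>{1..n}. 1 \<le> y i \<and> y i \<le> a i" "(\<Sum>i=1..n. y i) = M - k"
      using Suc.IH[OF a(1)] by blast
    have "(\<Sum>i=1..n. (y(Suc n := k)) i) = (\<Sum>i=1..n. y i)"
      by (rule sum.cong) auto
    then have "(\<Sum>i=1..Suc n. (y(Suc n := k)) i) = M"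
      using y(2) k(3) by simp
    moreover have "\<forall>i\<in>{1..Suc n}. 1 \<le> (y(Suc n := k)) i \<and> (y(Suc n := k)) i \<le> a i"
      using y(1) k(1,2) by auto
    ultimately show ?case by blast
  qed
  moreover have "n \<le> nat N" "nat N \<le> (\<Sum>i=1..n. a i)"
    using assms(2,3) by linarith+
  ultimately obtain y
    where y: "\<forall>i\<in>{1..n}. 1 \<le> y i \<and> y i \<le> a i" "(\<Sum>i=1..n. y i) = nat N"
    using assms(1) by metis
  then have "restrict y {1..n} \<in> distributions n a N"
    using assms(2) by (auto simp: distributions_def simp flip: of_nat_sum)
  then show ?thesis by blast
qed

definition abelian_p_group :: "nat \<Rightarrow> nat \<Rightarrow> (nat \<Rightarrow> nat) \<Rightarrow> (nat \<Rightarrow> int) monoid" where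
  "abelian_p_group p r v = sum_group {1..r} (\<lambda>i. integer_mod_group (p ^ v i))"

text \<open>
  Groups of \<^theory>\<open>HOL-Algebra.Group\<close> are written multiplicatively, so the linear combination
  \<open>a\<^sub>1 x\<^sub>1 + \<dots> + a\<^sub>n x\<^sub>n\<close> becomes a product of powers with integer exponents.
\<close>

definition num_solutions ::
    "('g, 'm) monoid_scheme \<Rightarrow> nat \<Rightarrow> (nat \<Rightarrow> int set) \<Rightarrow> (nat \<Rightarrow> 'g) \<Rightarrow> 'g \<Rightarrow> nat" where
  "num_solutions G n A x g =
     card {a \<in> \<Pi>\<^sub>E i\<in>{1..n}. A i. (\<Otimes>\<^bsub>G\<^esub>i\<in>{1..n}. x i [^]\<^bsub>G\<^esub> a i) = g}"

end

theory Submission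
  imports Defs "HOL-Number_Theory.Residues"
begin

text \<open>
  The system \<open>\<Sum>i. a i * x i = g\<close> in \<open>\<Oplus>j. \<int>/p^(v j)\<close> consists of one linear congruence modulo
  \<open>q = p^(v j)\<close> for each \<open>j\<close>. A natural number \<open>m\<close> satisfies \<open>m + 1 \<equiv> 0 (mod q)\<close> if and only
  if the binomial coefficient of \<open>m\<close> over \<open>q - 1\<close> is nonzero modulo \<open>p\<close>
  (\<open>prime_dvd_choose_pred_iff\<close>). Taking for \<open>m\<close> a sum of least residues that is congruent to
  \<open>\<Sum>i. a i * x i j - g j - 1\<close> modulo \<open>q\<close>, and expanding by Vandermonde's identity, one obtains sums
  of products of functions of the single variables \<open>a i\<close>. On the set \<open>A i\<close>, whose elements are
  incongruent modulo \<open>p\<close>, the function with lower index \<open>k\<close> agrees modulo \<open>p\<close> with a polynomial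
  of degree at most \<open>k\<close> (\<open>choose_poly_deg_le\<close>). Each congruence is therefore equivalent, on the
  grid \<open>\<Prod>i. A i\<close>, to the nonvanishing modulo \<open>p\<close> of a polynomial of degree at most \<open>q - 1\<close>
  (\<open>linear_cong_poly_deg_le\<close>), and the whole system to the nonvanishing of the product of these
  polynomials, of degree at most \<open>d = \<Sum>j. (p^(v j) - 1)\<close>.

  The lower bound is then the Alon-Fueredi theorem over the field with \<open>p\<close> elements
  (\<open>card_nonvanishing_ge_min_dist\<close>): a polynomial of degree at most \<open>d\<close> that does not vanish
  identically on a grid has at least \<open>\<mm>(#A\<^sub>1, \<dots>, #A\<^sub>n; \<Sum>i. #A\<^sub>i - d)\<close> nonzeros there. It is
  proved by induction on \<open>n\<close>. If the polynomial vanishes identically on the slices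
  \<open>a n = c\<close> for \<open>c\<close> in \<open>C\<close> and on no other slice, it agrees on the grid with
  \<open>\<Prod>c\<in>C. (a n - c)\<close> times a polynomial of degree at most \<open>d - #C\<close> (\<open>poly_deg_le_factor_prod\<close>), so
  that on each of the \<open>k\<close> remaining slices it is a nonzero polynomial of that
  degree. The bounds for these slices add up to \<open>k\<close> times the minimum for \<open>n - 1\<close> bins, and
  placing \<open>k\<close> balls into the last bin shows that this is large enough (\<open>min_dist_Suc_le\<close>).
\<close>

section \<open>Polynomial functions and their degrees\<close>

text \<open>
  \<open>poly_deg_le d f\<close> says that \<open>f\<close> is the function of a polynomial of total degree at most \<open>d\<close> in
  the variables \<open>a i\<close>, of which finitely many occur. The bound \<open>d\<close> is an integer, and for
  \<open>d < 0\<close> only the zero function qualifies; the degree can then drop by one in each application of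
  the factor theorem without a case distinction.
\<close>

inductive poly_deg_le :: "int \<Rightarrow> (('i \<Rightarrow> 'a::comm_ring_1) \<Rightarrow> 'a) \<Rightarrow> bool" where
  zero: "poly_deg_le d (\<lambda>_. 0)"
| const: "0 \<le> d \<Longrightarrow> poly_deg_le d (\<lambda>_. c)"
| var: "1 \<le> d \<Longrightarrow> poly_deg_le d (\<lambda>a. a i)"
| add: "poly_deg_le d f \<Longrightarrow> poly_deg_le d g \<Longrightarrow> poly_deg_le d (\<lambda>a. f a + g a)"
| mult: "poly_deg_le d f \<Longrightarrow> poly_deg_le e g \<Longrightarrow> poly_deg_le (d + e) (\<lambda>a. f a * g a)"

lemma poly_deg_le_mono:
  assumes "poly_deg_le d f" "d \<le> e"
  shows "poly_deg_le e f"
  using assms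
proof (induction arbitrary: e rule: poly_deg_le.induct)
  case (mult d f d' g e)
  have "poly_deg_le (d + (e - d)) (\<lambda>a. f a * g a)"
    using mult by (intro poly_deg_le.mult) auto
  then show ?case by simp
qed (auto intro: poly_deg_le.intros)

lemma poly_deg_le_neg:
  assumes "poly_deg_le d f" "d < 0"
  shows "f a = 0"
  using assms
proof (induction rule: poly_deg_le.induct)
  case (mult d f e g)
  then have "d < 0 \<or> e < 0" by linarith
  then show ?case using mult by auto
qed auto

lemma poly_deg_le_fun_upd:
  assumes "poly_deg_le d f"
  shows "poly_deg_le d (\<lambda>a. f (a(i := b)))"
  using assms
proof (induction rule: poly_deg_le.induct)
  case (var d j)
  then show ?case
    by (cases "j = i") (auto intro: poly_deg_le.const poly_deg_le.var)
qed (auto intro: poly_deg_le.intros)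

lemma poly_deg_le_cmult: "poly_deg_le d f \<Longrightarrow> poly_deg_le d (\<lambda>a. c * f a)"
  using poly_deg_le.mult[OF poly_deg_le.const[of 0 c]] by simp

lemma poly_deg_le_sum:
  assumes "\<And>i. i \<in> I \<Longrightarrow> poly_deg_le d (f i)"
  shows "poly_deg_le d (\<lambda>a. \<Sum>i\<in>I. f i a)"
  using assms
  by (induction I rule: infinite_finite_induct) (auto intro: poly_deg_le.intros)

lemma poly_deg_le_prod:
  assumes "\<And>i. i \<in> I \<Longrightarrow> poly_deg_le (d i) (f i)"
  shows "poly_deg_le (\<Sum>i\<in>I. d i) (\<lambda>a. \<Prod>i\<in>I. f i a)"
  using assms
  by (induction I rule: infinite_finite_induct) (auto intro: poly_deg_le.intros)

text \<open>
  The factor theorem in one variable, with the degree of the quotient counted in all variables.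
\<close>

lemma poly_deg_le_factor:
  fixes f :: "('i \<Rightarrow> 'a::comm_ring_1) \<Rightarrow> 'a"
  assumes "poly_deg_le d f"
  shows "\<exists>g. poly_deg_le (d - 1) g \<and> (\<forall>a. f a = f (a(i := c)) + (a i - c) * g a)"
  using assms
proof (induction rule: poly_deg_le.induct)
  case (zero d)
  then show ?case by (intro exI[of _ "\<lambda>_. 0"]) (auto intro: poly_deg_le.intros)
next
  case (const d k)
  then show ?case by (intro exI[of _ "\<lambda>_. 0"]) (auto intro: poly_deg_le.intros)
next
  case (var d j)
  then show ?case
    by (intro exI[of _ "\<lambda>_. if j = i then 1 else 0"])
       (auto intro: poly_deg_le.zero poly_deg_le.const)
next
  case (add d f1 f2)
  then obtain g1 g2 where "poly_deg_le (d - 1) g1" "poly_deg_le (d - 1) g2"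
    and *: "\<And>a. f1 a = f1 (a(i := c)) + (a i - c) * g1 a"
           "\<And>a. f2 a = f2 (a(i := c)) + (a i - c) * g2 a"
    by blast
  then have "poly_deg_le (d - 1) (\<lambda>a. g1 a + g2 a)"
    by (auto intro: poly_deg_le.add)
  moreover have "f1 a + f2 a
      = f1 (a(i := c)) + f2 (a(i := c)) + (a i - c) * (g1 a + g2 a)" for a
  proof -
    have "f1 a + f2 a = (f1 (a(i := c)) + (a i - c) * g1 a) + (f2 (a(i := c)) + (a i - c) * g2 a)"
      by (rule arg_cong2[OF *(1) *(2)])
    then show ?thesis by (simp only: algebra_simps)
  qed
  ultimately show ?case by (intro exI[of _ "\<lambda>a. g1 a + g2 a"] conjI allI)
next
  case (mult d f1 e f2)
  then obtain g1 g2 where g: "poly_deg_le (d - 1) g1" "poly_deg_le (e - 1) g2"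
    and *: "\<And>a. f1 a = f1 (a(i := c)) + (a i - c) * g1 a"
           "\<And>a. f2 a = f2 (a(i := c)) + (a i - c) * g2 a"
    by blast
  let ?g = "\<lambda>a. g1 a * f2 a + f1 (a(i := c)) * g2 a"
  have "poly_deg_le (d - 1 + e) (\<lambda>a. g1 a * f2 a)"
    by (intro poly_deg_le.mult g mult)
  moreover have "poly_deg_le (d + (e - 1)) (\<lambda>a. f1 (a(i := c)) * g2 a)"
    by (intro poly_deg_le.mult g poly_deg_le_fun_upd mult)
  ultimately have "poly_deg_le (d + e - 1) ?g"
    by (intro poly_deg_le.add) (auto simp: algebra_simps)
  moreover have "f1 a * f2 a = f1 (a(i := c)) * f2 (a(i := c)) + (a i - c) * ?g a" for a
  proof -
    have "f1 (a(i := c)) * f2 (a(i := c)) + (a i - c) * ?g a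
        = f1 (a(i := c)) * (f2 (a(i := c)) + (a i - c) * g2 a) + ((a i - c) * g1 a) * f2 a"
      by (simp add: algebra_simps)
    also have "\<dots> = (f1 (a(i := c)) + (a i - c) * g1 a) * f2 a"
      by (simp only: *(2)[of a, symmetric]) (simp add: algebra_simps)
    finally show ?thesis by (simp only: *(1)[of a, symmetric])
  qed
  ultimately show ?case by (intro exI[of _ ?g] conjI allI)
qed

text \<open>
  Modulo a prime, roots that are pairwise incongruent split off together. The set \<open>R\<close> consists of
  the points at which the values of the variables other than \<open>a i\<close> are read off.
\<close>

lemma poly_deg_le_factor_prod:
  fixes f :: "('i \<Rightarrow> int) \<Rightarrow> int"
  assumes p: "prime p" and "finite C" "pairwise (\<lambda>s t. \<not> [s = t] (mod p)) C"
    and f: "poly_deg_le d f"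
    and "\<And>a c. a \<in> R \<Longrightarrow> c \<in> C \<Longrightarrow> p dvd f (a(i := c))"
  shows "\<exists>g. poly_deg_le (d - int (card C)) g \<and>
    (\<forall>a\<in>R. \<forall>t. [f (a(i := t)) = (\<Prod>c\<in>C. t - c) * g (a(i := t))] (mod p))"
  using assms(2,3,5)
proof (induction C rule: finite_induct)
  case empty
  then show ?case using f by (intro exI[of _ f]) auto
next
  case (insert c C)
  have "\<exists>g. poly_deg_le (d - int (card C)) g \<and>
      (\<forall>a\<in>R. \<forall>t. [f (a(i := t)) = (\<Prod>c\<in>C. t - c) * g (a(i := t))] (mod p))"
    using insert.prems by (intro insert.IH) (auto simp only: pairwise_insert insert_iff)
  then obtain g where g: "poly_deg_le (d - int (card C)) g"
    and fg: "\<And>a t. a \<in> R \<Longrightarrow> [f (a(i := t)) = (\<Prod>c\<in>C. t - c) * g (a(i := t))] (mod p)"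
    by blast
  obtain h where h: "poly_deg_le (d - int (card C) - 1) h"
    and gh: "\<And>a. g a = g (a(i := c)) + (a i - c) * h a"
    using poly_deg_le_factor[OF g, of i c] by blast
  have "[f (a(i := t)) = (\<Prod>c\<in>insert c C. t - c) * h (a(i := t))] (mod p)" if a: "a \<in> R" for a t
  proof -
    have "\<not> p dvd (\<Prod>c'\<in>C. c - c')"
      using insert.hyps insert.prems(1) p
      by (auto simp: prime_dvd_prod_iff pairwise_insert cong_iff_dvd_diff)
    moreover have "p dvd (\<Prod>c'\<in>C. c - c') * g (a(i := c))"
      using cong_dvd_iff[OF fg[OF a, of c]] insert.prems(2)[OF a, of c] by simp
    ultimately have "p dvd g (a(i := c))"
      using p by (simp add: prime_dvd_mult_iff)
    then have "[g (a(i := t)) = (t - c) * h (a(i := t))] (mod p)"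
      using gh[of "a(i := t)"] by (simp add: cong_iff_dvd_diff)
    then have "[(\<Prod>c\<in>C. t - c) * g (a(i := t))
        = (\<Prod>c\<in>C. t - c) * ((t - c) * h (a(i := t)))] (mod p)"
      by (rule cong_scalar_left)
    then show ?thesis
      using cong_trans[OF fg[OF a]] insert.hyps by (simp add: mult_ac)
  qed
  then have "\<forall>a\<in>R. \<forall>t. [f (a(i := t)) = (\<Prod>c\<in>insert c C. t - c) * h (a(i := t))] (mod p)"
    by (intro ballI allI)
  moreover have "poly_deg_le (d - int (card (insert c C))) h"
    using h insert.hyps by (simp add: algebra_simps)
  ultimately show ?case by (intro exI[of _ h] conjI)
qed

section \<open>The minimal product of a distribution\<close>

lemma min_dist_le:
  assumes "y \<in> distributions n a N"
  shows "min_dist n a N \<le> (\<Prod>i=1..n. y i)"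
proof -
  have y: "\<And>i. i \<in> {1..n} \<Longrightarrow> 1 \<le> y i \<and> y i \<le> a i" "int (\<Sum>i=1..n. y i) = N"
    using assms by (auto simp: distributions_def PiE_iff simp del: of_nat_sum)
  have "n \<le> (\<Sum>i=1..n. y i)" "(\<Sum>i=1..n. y i) \<le> (\<Sum>i=1..n. a i)"
    using sum_mono[of "{1..n}" "\<lambda>_. 1" y] sum_mono[of "{1..n}" y a] y(1) by auto
  then have "\<not> N < int n" "\<not> N > int (\<Sum>i=1..n. a i)"
    using y(2) by linarith+
  then show ?thesis
    using assms finite_distributions
    by (simp add: min_dist_def del: of_nat_sum) 
qed

lemma distributions_extend:
  assumes "y \<in> distributions n a M" "1 \<le> k" "k \<le> a (Suc n)"
  shows "y(Suc n := k) \<in> distributions (Suc n) a (M + int k)"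
    and "(\<Prod>i=1..Suc n. (y(Suc n := k)) i) = k * (\<Prod>i=1..n. y i)"
proof -
  have "(\<Sum>i=1..n. (y(Suc n := k)) i) = (\<Sum>i=1..n. y i)"
    "(\<Prod>i=1..n. (y(Suc n := k)) i) = (\<Prod>i=1..n. y i)"
    by (auto intro: sum.cong prod.cong)
  then show "y(Suc n := k) \<in> distributions (Suc n) a (M + int k)"
    "(\<Prod>i=1..Suc n. (y(Suc n := k)) i) = k * (\<Prod>i=1..n. y i)"
    using assms
    by (auto simp: distributions_def PiE_iff extensional_def mult.commute simp del: of_nat_sum)
qed

text \<open>
  The value \<open>k\<close> for the last bin extends an optimal distribution for the first \<open>n\<close> bins. The lower
  convention of \<open>min_dist\<close>, the value 1 for too few balls, is compatible with this step. The last
  hypothesis keeps the upper convention out of play.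
\<close>

lemma min_dist_Suc_le:
  assumes a: "\<forall>i\<in>{1..n}. 1 \<le> a i"
    and k: "1 \<le> k" "k \<le> a (Suc n)" and N: "N - int k \<le> int (\<Sum>i=1..n. a i)"
  shows "min_dist (Suc n) a N \<le> k * min_dist n a (N - int k)"
proof (cases "N - int k < int n")
  case less: True
  show ?thesis
  proof (cases "N < int (Suc n)")
    case True
    then show ?thesis using less k by (simp add: min_dist_def)
  next
    case False
    \<comment> \<open>All bins but the last hold one ball, and the last one holds at most \<open>k\<close>.\<close>
    define l where "l = nat N - n"
    have l: "int l = N - int n" "1 \<le> l" "l \<le> k"
      using False less by (auto simp: l_def)
    define y :: "nat \<Rightarrow> nat" where "y = (\<lambda>i\<in>{1..n}. 1)"
    have "y \<in> distributions n a (int n)"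
      using a by (auto simp: y_def distributions_def PiE_iff)
    from distributions_extend[OF this l(2)] l(3) k(2)
    have "y(Suc n := l) \<in> distributions (Suc n) a N"
      "(\<Prod>i=1..Suc n. (y(Suc n := l)) i) = l * (\<Prod>i=1..n. y i)"
      using l(1) by simp_all
    moreover have "(\<Prod>i=1..n. y i) = 1"
      by (simp add: y_def)
    ultimately have "min_dist (Suc n) a N \<le> l"
      using min_dist_le by fastforce
    then show ?thesis using less l by (simp add: min_dist_def)
  qed
next
  case False
  let ?D = "distributions n a (N - int k)"
  have "?D \<noteq> {}"
    using a N False by (intro distributions_nonempty) auto
  then have "Min ((\<lambda>y. \<Prod>i=1..n. y i) ` ?D) \<in> (\<lambda>y. \<Prod>i=1..n. y i) ` ?D"
    using finite_distributions by (intro Min_in) auto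
  moreover have "min_dist n a (N - int k) = Min ((\<lambda>y. \<Prod>i=1..n. y i) ` ?D)"
    using N False by (simp add: min_dist_def)
  ultimately obtain y where y: "y \<in> ?D" "min_dist n a (N - int k) = (\<Prod>i=1..n. y i)"
    by auto
  show ?thesis
    using distributions_extend[OF y(1) k] min_dist_le[of "y(Suc n := k)" "Suc n" a N] y(2)
    by (simp add: mult.commute)
qed

section \<open>Nonvanishing points of a polynomial on a grid\<close>

text \<open>
  The Alon-Fueredi theorem over the field with \<open>p\<close> elements, for integer representatives.
\<close>

lemma card_nonvanishing_ge_min_dist:
  fixes f :: "(nat \<Rightarrow> int) \<Rightarrow> int"
  assumes p: "prime p" and "poly_deg_le d f"
    and "\<forall>i\<in>{1..n}. finite (A i)" "\<forall>i\<in>{1..n}. pairwise (\<lambda>s t. \<not> [s = t] (mod p)) (A i)"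
    and "a0 \<in> Pi\<^sub>E {1..n} A" "\<not> p dvd f a0"
  shows "min_dist n (\<lambda>i. card (A i)) (int (\<Sum>i=1..n. card (A i)) - d)
    \<le> card {a \<in> Pi\<^sub>E {1..n} A. \<not> p dvd f a}"
  using assms(2-)
proof (induction n arbitrary: d f a0)
  case 0
  then have "d \<ge> 0"
    using poly_deg_le_neg[of d f a0] by (cases "d < 0") auto
  moreover have "{a \<in> Pi\<^sub>E {1..0} A. \<not> p dvd f a} = {a0}"
    using 0 by auto
  moreover have "min_dist 0 (\<lambda>i. card (A i)) (- d) \<le> 1"
    using min_dist_le[of "\<lambda>_. undefined" 0 "\<lambda>i. card (A i)" "- d"] \<open>d \<ge> 0\<close>
    by (cases "d = 0") (auto simp: distributions_def, simp add: min_dist_def)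
  ultimately show ?case by simp
next
  case (Suc n)
  let ?m = "Suc n" and ?R = "Pi\<^sub>E {1..n} A" and ?c = "\<lambda>i. card (A i)"
  \<comment> \<open>The slices on which \<open>f\<close> vanishes modulo \<open>p\<close>, and the others\<close>
  define C where "C = {c \<in> A ?m. \<forall>a\<in>?R. p dvd f (a(?m := c))}"
  define B where "B = A ?m - C"
  have BE: "\<exists>a\<in>?R. \<not> p dvd f (a(?m := b))" if "b \<in> B" for b
    using that unfolding B_def C_def by blast
  have BI: "b \<in> B" if "b \<in> A ?m" "a \<in> ?R" "\<not> p dvd f (a(?m := b))" for a b
    using that unfolding B_def C_def by blast
  have fin: "finite (A ?m)" "finite C" "finite B" and CA: "C \<subseteq> A ?m"
    using Suc.prems(2) by (auto simp: C_def B_def)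
  then have cardB: "card B = card (A ?m) - card C" "card C \<le> card (A ?m)"
    unfolding B_def by (auto intro: card_Diff_subset card_mono)
  have ne: "A i \<noteq> {}" if "i \<in> {1..n}" for i
    using that Suc.prems(4) by (auto simp: PiE_iff)
  then have pos: "\<forall>i\<in>{1..n}. 1 \<le> ?c i"
    using Suc.prems(2) by (auto simp: Suc_le_eq card_gt_0_iff)
  have pw: "pairwise (\<lambda>s t. \<not> [s = t] (mod p)) (A ?m)"
    using Suc.prems(3) by simp
  then have "pairwise (\<lambda>s t. \<not> [s = t] (mod p)) C"
    by (rule pairwise_subset) (rule CA)
  then obtain g where g: "poly_deg_le (d - int (card C)) g"
    and fg: "\<And>a t. a \<in> ?R \<Longrightarrow> [f (a(?m := t)) = (\<Prod>c\<in>C. t - c) * g (a(?m := t))] (mod p)"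
    using poly_deg_le_factor_prod[OF p fin(2) _ Suc.prems(1), of ?R ?m]
    unfolding C_def by blast
  have unit: "\<not> p dvd (\<Prod>c\<in>C. b - c)" if "b \<in> B" for b
  proof -
    have "\<not> p dvd b - c" if "c \<in> C" for c
    proof -
      have "b \<in> A ?m" "c \<in> A ?m" "b \<noteq> c"
        using \<open>b \<in> B\<close> that CA by (auto simp only: B_def)
      then show ?thesis
        using pw by (simp add: pairwise_def cong_iff_dvd_diff)
    qed
    then show ?thesis using p fin(2) by (simp add: prime_dvd_prod_iff)
  qed
  have iff: "p dvd f (a(?m := b)) \<longleftrightarrow> p dvd g (a(?m := b))" if "a \<in> ?R" "b \<in> B" for a b
    using cong_dvd_iff[OF fg[OF that(1), of b]] unit[OF that(2)] p
    by (simp only: prime_dvd_mult_iff) simp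
  let ?S = "\<lambda>b. {a \<in> ?R. \<not> p dvd g (a(?m := b))}"
  let ?N = "int (\<Sum>i=1..?m. ?c i) - d"
  have N: "?N - int (card B) = int (\<Sum>i=1..n. ?c i) - (d - int (card C))"
    using cardB by simp
  have each: "min_dist n ?c (?N - int (card B)) \<le> card (?S b)" if b: "b \<in> B" for b
  proof -
    obtain a where "a \<in> ?R" "\<not> p dvd f (a(?m := b))"
      using BE[OF b] by blast
    then have a: "a \<in> ?R" "\<not> p dvd g (a(?m := b))"
      using iff[OF _ b] by auto
    show ?thesis
      unfolding N using Suc.prems(2,3)
      by (intro Suc.IH[OF poly_deg_le_fun_upd[OF g] _ _ a]) auto
  qed
  have "B \<noteq> {}"
  proof
    assume "B = {}"
    \<comment> \<open>Elements of \<open>?R\<close> are undefined at \<open>?m\<close>.\<close>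
    have "a0(?m := undefined) \<in> ?R" "a0 ?m \<in> A ?m"
      using Suc.prems(4) by (auto simp: PiE_iff extensional_def)
    moreover have "a0(?m := undefined, ?m := a0 ?m) = a0" by simp
    ultimately show False
      using BI[of "a0 ?m" "a0(?m := undefined)"] Suc.prems(5) \<open>B = {}\<close> by simp
  qed
  then obtain b where b: "b \<in> B" by blast
  have "0 \<le> d - int (card C)"
  proof (rule ccontr)
    assume "\<not> 0 \<le> d - int (card C)"
    then have "g a = 0" for a using poly_deg_le_neg[OF g] by simp
    then show False using BE[OF b] iff[OF _ b] by auto
  qed
  then have "?N - int (card B) \<le> int (\<Sum>i=1..n. ?c i)" unfolding N by linarith
  moreover have "1 \<le> card B"
    using \<open>B \<noteq> {}\<close> fin by (simp add: Suc_le_eq card_gt_0_iff)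
  ultimately have "min_dist ?m ?c ?N \<le> card B * min_dist n ?c (?N - int (card B))"
    using cardB by (intro min_dist_Suc_le pos) auto
  also have "\<dots> = (\<Sum>b\<in>B. min_dist n ?c (?N - int (card B)))" by simp
  also have "\<dots> \<le> (\<Sum>b\<in>B. card (?S b))" by (intro sum_mono each)
  also have "\<dots> = card (SIGMA b:B. ?S b)"
    using fin Suc.prems(2) by (subst card_SigmaI) (auto intro!: finite_PiE finite_Collect_conjI)
  also have "\<dots> = card ((\<lambda>(b, a). a(?m := b)) ` (SIGMA b:B. ?S b))"
  proof (rule card_image[symmetric])
    have "inj_on (\<lambda>(b, a). a(?m := b)) (A ?m \<times> ?R)"
      by (rule inj_combinator) auto
    then show "inj_on (\<lambda>(b, a). a(?m := b)) (SIGMA b:B. ?S b)"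
      by (rule inj_on_subset) (auto simp: B_def)
  qed
  also have "\<dots> \<le> card {a \<in> Pi\<^sub>E {1..?m} A. \<not> p dvd f a}"
  proof (rule card_mono)
    show "finite {a \<in> Pi\<^sub>E {1..?m} A. \<not> p dvd f a}"
      using Suc.prems(2) by (intro finite_subset[OF _ finite_PiE[of "{1..?m}" A]]) auto
    show "(\<lambda>(b, a). a(?m := b)) ` (SIGMA b:B. ?S b) \<subseteq> {a \<in> Pi\<^sub>E {1..?m} A. \<not> p dvd f a}"
      using iff by (auto simp: B_def PiE_iff extensional_def)
  qed
  finally show ?case .
qed

section \<open>Binomial coefficients modulo a prime\<close>

lemma prime_dvd_choose_prime_power:
  fixes p :: nat
  assumes p: "prime p" and j: "0 < j" "j < p ^ v"
  shows "p dvd (p ^ v choose j)"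
proof (rule ccontr)
  assume "\<not> p dvd (p ^ v choose j)"
  then have "coprime (p ^ v) (p ^ v choose j)"
    using p by (simp add: prime_imp_coprime)
  moreover have "p ^ v dvd j * (p ^ v choose j)"
    using j by (simp add: times_binomial_minus1_eq)
  ultimately have "p ^ v dvd j"
    by (simp add: coprime_dvd_mult_left_iff)
  then show False using j by (auto dest: dvd_imp_le)
qed

lemma choose_add_prime_power_cong:
  fixes p :: nat
  assumes p: "prime p" and k: "k < p ^ v"
  shows "[(p ^ v + m) choose k = m choose k] (mod p)"
proof -
  have "(p ^ v + m) choose k = (\<Sum>j\<le>k. (p ^ v choose j) * (m choose (k - j)))"
    by (rule vandermonde[symmetric])
  also have "[\<dots> = (\<Sum>j\<le>k. if j = 0 then m choose k else 0)] (mod p)"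
    using prime_dvd_choose_prime_power[OF p, of _ v] k
    by (intro cong_sum) (auto simp: cong_0_iff)
  finally show ?thesis by simp
qed

lemma choose_mod_prime_power_cong:
  fixes p :: nat
  assumes "prime p" "k < p ^ v"
  shows "[m choose k = (m mod p ^ v) choose k] (mod p)"
proof -
  have "[(p ^ v * t + s) choose k = s choose k] (mod p)" for t s
  proof (induction t)
    case (Suc t)
    have "[(p ^ v + (p ^ v * t + s)) choose k = (p ^ v * t + s) choose k] (mod p)"
      by (rule choose_add_prime_power_cong[OF assms])
    then show ?case using Suc cong_trans by (simp add: add.assoc) blast
  qed auto
  from this[of "m div p ^ v" "m mod p ^ v"] show ?thesis by simp
qed

text \<open>
  Divisibility by \<open>p ^ v\<close> is detected modulo \<open>p\<close> by a single binomial coefficient. By periodicity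
  it suffices to look at \<open>m < p ^ v\<close>, where the coefficient is 1 for \<open>m = p ^ v - 1\<close> and 0 otherwise.
\<close>

lemma prime_dvd_choose_pred_iff:
  fixes p :: nat
  assumes p: "prime p"
  shows "p dvd (m choose (p ^ v - 1)) \<longleftrightarrow> \<not> p ^ v dvd Suc m"
proof -
  have q: "0 < p ^ v" using p by (simp add: prime_gt_0_nat)
  have "p dvd (m choose (p ^ v - 1)) \<longleftrightarrow> p dvd (m mod p ^ v choose (p ^ v - 1))"
    using q by (intro cong_dvd_iff choose_mod_prime_power_cong p) simp
  also have "\<dots> \<longleftrightarrow> m mod p ^ v \<noteq> p ^ v - 1"
  proof (cases "m mod p ^ v = p ^ v - 1")
    case True
    then show ?thesis using p by (auto simp: prime_nat_iff)
  next
    case False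
    then have "m mod p ^ v < p ^ v - 1"
      using mod_less_divisor[OF q, of m] by linarith
    then show ?thesis by (simp add: binomial_eq_0)
  qed
  also have "\<dots> \<longleftrightarrow> \<not> p ^ v dvd Suc m"
    using q by (auto simp: dvd_eq_mod_eq_0 mod_Suc)
  finally show ?thesis .
qed

lemma fact_times_choose_int: "fact k * int (m choose k) = (\<Prod>i<k. int m - int i)"
proof (induction k)
  case (Suc k)
  have "int (Suc k) * int (m choose Suc k) = (int m - int k) * int (m choose k)"
  proof (cases "k \<le> m")
    case True
    have "Suc k * (m choose Suc k) = (m - k) * (m choose k)"
      by (metis binomial_absorption binomial_absorb_comp)
    then show ?thesis
      using True by (metis of_nat_mult of_nat_diff)
  qed (simp add: binomial_eq_0)
  then have "fact (Suc k) * int (m choose Suc k) = (fact k * int (m choose k)) * (int m - int k)"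
    by (simp only: fact_Suc of_nat_mult mult_ac)
  then show ?case
    using Suc by simp
qed simp

lemma fermat_theorem_int:
  fixes a :: int
  assumes p: "prime p" and a: "\<not> int p dvd a"
  shows "[a ^ (p - 1) = 1] (mod int p)"
proof -
  let ?b = "nat (a mod int p)"
  have b: "int ?b = a mod int p"
    using p by (simp add: prime_gt_0_nat)
  then have "\<not> p dvd ?b"
    using a by (metis dvd_mod_iff dvd_refl int_dvd_int_iff)
  then have "[int (?b ^ (p - 1)) = int 1] (mod int p)"
    using fermat_theorem[OF p] cong_int_iff by blast
  then show ?thesis
    unfolding of_nat_power b by (simp add: cong_def power_mod)
qed

section \<open>Linear conditions as polynomial conditions\<close>

text \<open>
  Here \<open>m t\<close> is congruent to \<open>x * t\<close> modulo \<open>p\<close>, but not necessarily a polynomial in \<open>t\<close>.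
  For \<open>j < p\<close> the factorial of \<open>j\<close> is invertible modulo \<open>p\<close>, so that the binomial coefficient is
  modulo \<open>p\<close> a polynomial in \<open>t\<close> of degree at most \<open>j\<close>. For \<open>j \<ge> p\<close> it depends on more than
  \<open>m t\<close> modulo \<open>p\<close>, but every function on a finite set of pairwise incongruent integers is
  interpolated modulo \<open>p\<close> in degree at most \<open>p - 1\<close>, hence at most \<open>j\<close>.
\<close>

lemma choose_poly_deg_le:
  fixes p :: nat and A :: "int set" and i :: 'i
  assumes p: "prime p" and A: "finite A" "pairwise (\<lambda>s t. \<not> [s = t] (mod int p)) A"
    and m: "\<And>t. t \<in> A \<Longrightarrow> [int (m t) = x * t] (mod int p)"
  shows "\<exists>h :: ('i \<Rightarrow> int) \<Rightarrow> int. poly_deg_le (int j) h \<and>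
    (\<forall>a. a i \<in> A \<longrightarrow> [int (m (a i) choose j) = h a] (mod int p))"
proof (cases "j < p")
  case True
  then have "\<not> p dvd fact j"
    using p by (simp add: prime_dvd_fact_iff)
  then have "coprime (int (fact j)) (int p)"
    using p by (metis coprime_commute coprime_int_iff prime_imp_coprime)
  then obtain u where "[int (fact j) * u = 1] (mod int p)"
    using cong_solve_coprime_int by blast
  then have u: "[u * fact j = 1] (mod int p)" by (simp add: mult.commute)
  define h where "h = (\<lambda>a :: 'i \<Rightarrow> int. u * (\<Prod>l<j. x * a i + (- int l)))"
  have "poly_deg_le (\<Sum>l<j. 1) (\<lambda>a :: 'i \<Rightarrow> int. \<Prod>l<j. x * a i + (- int l))"
    by (intro poly_deg_le_prod poly_deg_le.add poly_deg_le_cmult poly_deg_le.var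
        poly_deg_le.const) auto
  then have "poly_deg_le (int j) h"
    unfolding h_def by (intro poly_deg_le_cmult) simp
  moreover have "[int (m (a i) choose j) = h a] (mod int p)" if "a i \<in> A" for a
  proof -
    let ?c = "int (m (a i) choose j)"
    have "[1 * ?c = u * fact j * ?c] (mod int p)"
      using u by (intro cong_scalar_right) (simp add: cong_sym)
    also have "u * fact j * ?c = u * (\<Prod>l<j. int (m (a i)) + (- int l))"
      by (simp add: mult.assoc fact_times_choose_int)
    also have "[\<dots> = h a] (mod int p)"
      unfolding h_def by (intro cong_scalar_left cong_prod cong_add m that) auto
    finally show ?thesis by simp
  qed
  ultimately show ?thesis by (intro exI[of _ h] conjI allI impI)
next
  case False
  define h where
    "h = (\<lambda>a :: 'i \<Rightarrow> int. \<Sum>s\<in>A. int (m s choose j) * (1 + (-1) * (\<Prod>l<p - 1. a i + (- s))))"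
  have "poly_deg_le (\<Sum>l<p - 1. 1) (\<lambda>a :: 'i \<Rightarrow> int. \<Prod>l<p - 1. a i + (- s))" for s
    by (intro poly_deg_le_prod poly_deg_le.add poly_deg_le.var poly_deg_le.const) auto
  then have "poly_deg_le (int j) (\<lambda>a :: 'i \<Rightarrow> int. \<Prod>l<p - 1. a i + (- s))" for s
    by (rule poly_deg_le_mono) (use False in simp)
  then have "poly_deg_le (int j) h"
    unfolding h_def
    by (intro poly_deg_le_sum poly_deg_le_cmult poly_deg_le.add poly_deg_le.const) auto
  moreover have "[int (m (a i) choose j) = h a] (mod int p)" if a: "a i \<in> A" for a
  proof -
    \<comment> \<open>By Fermat's little theorem, the factor is the indicator of \<open>s = a i\<close> modulo \<open>p\<close>,
      because distinct elements of \<open>A\<close> are incongruent.\<close>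
    have "[(if s = a i then 1 else 0) = 1 - (a i - s) ^ (p - 1)] (mod int p)" if s: "s \<in> A" for s
    proof (cases "s = a i")
      case True
      then show ?thesis using prime_gt_1_nat[OF p] by (simp add: power_0_left)
    next
      case neq: False
      then have "\<not> int p dvd a i - s"
        using A(2) a s by (auto simp: pairwise_def cong_iff_dvd_diff)
      from cong_diff[OF cong_refl[of 1] fermat_theorem_int[OF p this]]
      show ?thesis using neq by (simp add: cong_sym)
    qed
    then have "[(\<Sum>s\<in>A. int (m s choose j) * (if s = a i then 1 else 0))
        = (\<Sum>s\<in>A. int (m s choose j) * (1 - (a i - s) ^ (p - 1)))] (mod int p)"
      by (intro cong_sum cong_scalar_left) auto
    then show ?thesis
      using A(1) a by (simp add: h_def if_distrib cong: if_cong)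
  qed
  ultimately show ?thesis by (intro exI[of _ h] conjI allI impI)
qed

text \<open>
  By Vandermonde's identity, adding a variable convolves two families of binomial coefficients in
  which the lower indices, and with them the degrees, add up to \<open>k\<close>.
\<close>

lemma choose_sum_poly_deg_le:
  fixes p :: nat and A :: "'i \<Rightarrow> int set"
  assumes p: "prime p" and "finite I"
    and "\<And>i. i \<in> I \<Longrightarrow> finite (A i)"
    and "\<And>i. i \<in> I \<Longrightarrow> pairwise (\<lambda>s t. \<not> [s = t] (mod int p)) (A i)"
    and "\<And>i t. i \<in> I \<Longrightarrow> t \<in> A i \<Longrightarrow> [int (m i t) = x i * t] (mod int p)"
  shows "\<exists>h. poly_deg_le (int k) h \<and>
    (\<forall>a. (\<forall>i\<in>I. a i \<in> A i) \<longrightarrow> [int ((c + (\<Sum>i\<in>I. m i (a i))) choose k) = h a] (mod int p))"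
  using assms(2-)
proof (induction I arbitrary: k rule: finite_induct)
  case empty
  then show ?case
    by (intro exI[of _ "\<lambda>_. int (c choose k)"]) (auto intro: poly_deg_le.const)
next
  case (insert i I)
  have "\<forall>j. \<exists>h. poly_deg_le (int j) h \<and>
      (\<forall>a. (\<forall>i\<in>I. a i \<in> A i) \<longrightarrow> [int ((c + (\<Sum>i\<in>I. m i (a i))) choose j) = h a] (mod int p))"
    using insert by simp
  then obtain h1 where h1: "\<And>j. poly_deg_le (int j) (h1 j)"
    "\<And>j a. (\<forall>i\<in>I. a i \<in> A i) \<Longrightarrow> [int ((c + (\<Sum>i\<in>I. m i (a i))) choose j) = h1 j a] (mod int p)"
    by metis
  have "\<forall>j. \<exists>h :: ('i \<Rightarrow> int) \<Rightarrow> int. poly_deg_le (int j) h \<and>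
      (\<forall>a. a i \<in> A i \<longrightarrow> [int (m i (a i) choose j) = h a] (mod int p))"
    using insert.prems by (intro allI choose_poly_deg_le[OF p, where x = "x i"]) auto
  then obtain h2 where h2: "\<And>j. poly_deg_le (int j) (h2 j)"
    "\<And>j a :: 'i \<Rightarrow> int. a i \<in> A i \<Longrightarrow> [int (m i (a i) choose j) = h2 j a] (mod int p)"
    by metis
  define h where "h = (\<lambda>a. \<Sum>j\<le>k. h2 j a * h1 (k - j) a)"
  have "poly_deg_le (int j + int (k - j)) (\<lambda>a. h2 j a * h1 (k - j) a)" for j
    by (intro poly_deg_le.mult h1 h2)
  moreover have "int j + int (k - j) = int k" if "j \<le> k" for j
    using that by simp
  ultimately have "poly_deg_le (int k) h"
    unfolding h_def by (intro poly_deg_le_sum) (metis atMost_iff)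
  moreover have "[int ((c + (\<Sum>i\<in>insert i I. m i (a i))) choose k) = h a] (mod int p)"
    if "\<forall>i\<in>insert i I. a i \<in> A i" for a
  proof -
    have "c + (\<Sum>i\<in>insert i I. m i (a i)) = m i (a i) + (c + (\<Sum>i\<in>I. m i (a i)))"
      using insert.hyps by simp
    then have "int ((c + (\<Sum>i\<in>insert i I. m i (a i))) choose k)
        = (\<Sum>j\<le>k. int (m i (a i) choose j) * int ((c + (\<Sum>i\<in>I. m i (a i))) choose (k - j)))"
      by (simp only: vandermonde[symmetric] of_nat_sum of_nat_mult)
    also have "[\<dots> = h a] (mod int p)"
      unfolding h_def using that by (intro cong_sum cong_mult h1 h2) auto
    finally show ?thesis .
  qed
  ultimately show ?case by (intro exI[of _ h] conjI allI impI)
qed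

lemma linear_cong_poly_deg_le:
  fixes p :: nat and A :: "'i \<Rightarrow> int set"
  assumes p: "prime p" and "1 \<le> v" and "finite I"
    and "\<And>i. i \<in> I \<Longrightarrow> finite (A i)"
    and "\<And>i. i \<in> I \<Longrightarrow> pairwise (\<lambda>s t. \<not> [s = t] (mod int p)) (A i)"
  shows "\<exists>h. poly_deg_le (int p ^ v - 1) h \<and>
    (\<forall>a. (\<forall>i\<in>I. a i \<in> A i) \<longrightarrow>
      (int p dvd h a \<longleftrightarrow> \<not> [(\<Sum>i\<in>I. a i * x i) = g] (mod int p ^ v)))"
proof -
  \<comment> \<open>Least residues keep the upper index a natural number; \<open>c\<close> also absorbs the shift by one in
    \<open>prime_dvd_choose_pred_iff\<close>.\<close>
  define m where "m = (\<lambda>i t. nat (x i * t mod int p ^ v))"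
  define c where "c = nat ((- g - 1) mod int p ^ v)"
  have q: "0 < int p ^ v" using p by (simp add: prime_gt_0_nat)
  have m: "int (m i t) = x i * t mod int p ^ v" for i t
    using q by (simp add: m_def)
  have c: "int c = (- g - 1) mod int p ^ v"
    using q by (simp add: c_def)
  have "int p dvd int p ^ v" using assms(2) by (simp add: dvd_power)
  then have "[int (m i t) = x i * t] (mod int p)" for i t
    unfolding m by (simp add: cong_def mod_mod_cancel)
  then have "\<exists>h. poly_deg_le (int (p ^ v - 1)) h \<and> (\<forall>a. (\<forall>i\<in>I. a i \<in> A i) \<longrightarrow>
      [int ((c + (\<Sum>i\<in>I. m i (a i))) choose (p ^ v - 1)) = h a] (mod int p))"
    by (intro choose_sum_poly_deg_le p assms(3-5))
  then obtain h where h: "poly_deg_le (int (p ^ v - 1)) h"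
    and hc: "\<And>a. (\<forall>i\<in>I. a i \<in> A i) \<Longrightarrow>
      [int ((c + (\<Sum>i\<in>I. m i (a i))) choose (p ^ v - 1)) = h a] (mod int p)"
    by blast
  have "int p dvd h a \<longleftrightarrow> \<not> [(\<Sum>i\<in>I. a i * x i) = g] (mod int p ^ v)"
    if a: "\<forall>i\<in>I. a i \<in> A i" for a
  proof -
    let ?M = "c + (\<Sum>i\<in>I. m i (a i))"
    have "int p dvd h a \<longleftrightarrow> int p dvd int (?M choose (p ^ v - 1))"
      using cong_dvd_iff[OF hc[OF a]] by blast
    also have "\<dots> \<longleftrightarrow> \<not> p ^ v dvd Suc ?M"
      by (simp only: int_dvd_int_iff prime_dvd_choose_pred_iff[OF p])
    also have "p ^ v dvd Suc ?M \<longleftrightarrow> int p ^ v dvd int (Suc ?M)"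
      by (metis int_dvd_int_iff of_nat_power)
    also have "\<dots> \<longleftrightarrow> int p ^ v dvd (\<Sum>i\<in>I. a i * x i) - g"
    proof (rule cong_dvd_iff)
      have "[1 + (int c + (\<Sum>i\<in>I. int (m i (a i))))
          = 1 + ((- g - 1) + (\<Sum>i\<in>I. a i * x i))] (mod int p ^ v)"
        unfolding m c
        by (intro cong_add cong_sum cong_refl) (simp_all add: cong_def mult.commute)
      then show "[int (Suc ?M) = (\<Sum>i\<in>I. a i * x i) - g] (mod int p ^ v)"
        by simp
    qed
    finally show ?thesis by (simp add: cong_iff_dvd_diff)
  qed
  moreover have "int (p ^ v - 1) = int p ^ v - 1"
    using p by (simp add: of_nat_diff Suc_leI prime_gt_0_nat)
  then have "poly_deg_le (int p ^ v - 1) h"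
    using h by (simp only:)
  ultimately show ?thesis by (intro exI[of _ h] conjI allI impI)
qed

section \<open>Linear combinations in a sum of cyclic groups\<close>

lemma comm_group_sum_group:
  assumes "\<And>i. i \<in> I \<Longrightarrow> comm_group (G i)"
  shows "comm_group (sum_group I G)"
proof -
  have grp: "\<And>i. i \<in> I \<Longrightarrow> group (G i)"
    using assms by (simp add: comm_group.axioms(2))
  show ?thesis
  proof (rule group.group_comm_groupI[OF sum_group[OF grp]])
    fix x y
    assume "x \<in> carrier (sum_group I G)" "y \<in> carrier (sum_group I G)"
    then show "x \<otimes>\<^bsub>sum_group I G\<^esub> y = y \<otimes>\<^bsub>sum_group I G\<^esub> x"
      using assms
      by (auto simp: carrier_sum_group grp PiE_iff intro!: restrict_ext
          comm_monoid.m_comm[OF comm_group.axioms(1)])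
  qed
qed

lemma int_pow_sum_group:
  assumes G: "\<And>i. i \<in> I \<Longrightarrow> group (G i)" and x: "x \<in> carrier (sum_group I G)" and i: "i \<in> I"
  shows "(x [^]\<^bsub>sum_group I G\<^esub> (k :: int)) i = x i [^]\<^bsub>G i\<^esub> k"
proof -
  have "(\<lambda>y. y i) \<in> hom (sum_group I G) (G i)"
    using G i by (auto simp: hom_def carrier_sum_group PiE_iff)
  then have "group_hom (sum_group I G) (G i) (\<lambda>y. y i)"
    using G i by (simp add: group_hom_def group_hom_axioms_def)
  then show ?thesis using x by (rule group_hom.hom_int_pow)
qed

lemma finprod_sum_integer_mod_group:
  fixes q :: "'j \<Rightarrow> nat" and J :: "'j set"
  defines "G \<equiv> sum_group J (\<lambda>j. integer_mod_group (q j))"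
  assumes x: "\<And>i. i \<in> I \<Longrightarrow> x i \<in> carrier G" and j: "j \<in> J" and "finite I"
  shows "(\<Otimes>\<^bsub>G\<^esub>i\<in>I. x i [^]\<^bsub>G\<^esub> (a i :: int)) j = (\<Sum>i\<in>I. a i * x i j) mod int (q j)"
proof -
  interpret comm_group G
    unfolding G_def by (rule comm_group_sum_group) simp
  show ?thesis
    using \<open>finite I\<close> x
  proof (induction I rule: finite_induct)
    case empty
    have "(\<Otimes>\<^bsub>G\<^esub>i\<in>{}. x i [^]\<^bsub>G\<^esub> a i) j = \<one>\<^bsub>G\<^esub> j"
      by simp
    then show ?case using j by (simp add: G_def)
  next
    case (insert i I)
    have "(x i [^]\<^bsub>G\<^esub> a i) j = x i j [^]\<^bsub>integer_mod_group (q j)\<^esub> a i"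
      using insert.prems j unfolding G_def by (intro int_pow_sum_group) auto
    then have pow: "(x i [^]\<^bsub>G\<^esub> a i) j = a i * x i j mod int (q j)"
      by (simp add: int_pow_integer_mod_group)
    have "(\<Otimes>\<^bsub>G\<^esub>i\<in>insert i I. x i [^]\<^bsub>G\<^esub> a i)
        = x i [^]\<^bsub>G\<^esub> a i \<otimes>\<^bsub>G\<^esub> (\<Otimes>\<^bsub>G\<^esub>i\<in>I. x i [^]\<^bsub>G\<^esub> a i)"
      using insert by (intro finprod_insert) auto
    then have "(\<Otimes>\<^bsub>G\<^esub>i\<in>insert i I. x i [^]\<^bsub>G\<^esub> a i) j
        = ((x i [^]\<^bsub>G\<^esub> a i) j + (\<Otimes>\<^bsub>G\<^esub>i\<in>I. x i [^]\<^bsub>G\<^esub> a i) j) mod int (q j)"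
      using j by (simp add: G_def)
    then show ?case
      using insert pow by (simp add: mod_add_eq)
  qed
qed

lemma finprod_eq_iff_cong:
  fixes q :: "'j \<Rightarrow> nat" and J :: "'j set"
  defines "G \<equiv> sum_group J (\<lambda>j. integer_mod_group (q j))"
  assumes q: "\<And>j. j \<in> J \<Longrightarrow> 0 < q j"
    and x: "\<And>i. i \<in> I \<Longrightarrow> x i \<in> carrier G" and g: "g \<in> carrier G" and "finite I"
  shows "(\<Otimes>\<^bsub>G\<^esub>i\<in>I. x i [^]\<^bsub>G\<^esub> (a i :: int)) = g
    \<longleftrightarrow> (\<forall>j\<in>J. [(\<Sum>i\<in>I. a i * x i j) = g j] (mod int (q j)))"
proof -
  interpret comm_group G
    unfolding G_def by (rule comm_group_sum_group) simp
  let ?l = "\<Otimes>\<^bsub>G\<^esub>i\<in>I. x i [^]\<^bsub>G\<^esub> a i"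
  have "?l \<in> carrier G"
    using x by (intro finprod_closed) auto
  then have "?l \<in> extensional J" "g \<in> extensional J"
    using g by (auto simp: G_def carrier_sum_group PiE_iff)
  then have eq: "?l = g \<longleftrightarrow> (\<forall>j\<in>J. ?l j = g j)"
    by (auto intro: extensionalityI simp only:)
  have l: "?l j = (\<Sum>i\<in>I. a i * x i j) mod int (q j)" if "j \<in> J" for j
    using x that \<open>finite I\<close> unfolding G_def by (rule finprod_sum_integer_mod_group)
  have g_mod: "g j = g j mod int (q j)" if "j \<in> J" for j
    using g that q[OF that] by (auto simp: G_def carrier_sum_group carrier_integer_mod_group PiE_iff)
  have "?l j = g j \<longleftrightarrow> [(\<Sum>i\<in>I. a i * x i j) = g j] (mod int (q j))" if "j \<in> J" for j
    unfolding l[OF that] cong_def g_mod[OF that, symmetric] ..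
  then show ?thesis unfolding eq by blast
qed

section \<open>Counting solutions\<close>

theorem theorem4p6:
  fixes p r n :: nat
    and v :: "nat \<Rightarrow> nat"
    and x :: "nat \<Rightarrow> nat \<Rightarrow> int"
    and A :: "nat \<Rightarrow> int set"
    and g :: "nat \<Rightarrow> int"
  assumes "prime p"
    and "r \<ge> 1" and "\<forall>i\<in>{1..r}. v i \<ge> 1"
    and "n \<ge> 1"
    and "\<forall>i\<in>{1..n}. x i \<in> carrier (abelian_p_group p r v)"
    and "\<forall>i\<in>{1..n}. A i \<noteq> {}"
    and "\<forall>i\<in>{1..n}. pairwise (\<lambda>s t. \<not> [s = t] (mod int p)) (A i)"
    and "g \<in> carrier (abelian_p_group p r v)"
  shows "num_solutions (abelian_p_group p r v) n A x g = 0 \<or>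
         num_solutions (abelian_p_group p r v) n A x g \<ge>
           min_dist n (\<lambda>i. card (A i))
             (int (\<Sum>i=1..n. card (A i)) - (\<Sum>i=1..r. (int p ^ v i - 1)))"
proof -
  let ?G = "abelian_p_group p r v" and ?d = "\<Sum>j=1..r. (int p ^ v j - 1)"
  have p: "prime p" "0 < p"
    using assms(1) by (auto simp: prime_gt_0_nat)
  have fin: "finite (A i)" if "i \<in> {1..n}" for i
  proof (rule inj_on_finite)
    show "inj_on (\<lambda>s. s mod int p) (A i)"
      using assms(7) that by (fastforce simp: inj_on_def pairwise_def cong_def)
    show "(\<lambda>s. s mod int p) ` A i \<subseteq> {0..<int p}"
      using p by auto
  qed simp
  have "\<forall>j\<in>{1..r}. \<exists>h. poly_deg_le (int p ^ v j - 1) h \<and>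
      (\<forall>a. (\<forall>i\<in>{1..n}. a i \<in> A i) \<longrightarrow>
        (int p dvd h a \<longleftrightarrow> \<not> [(\<Sum>i=1..n. a i * x i j) = g j] (mod int p ^ v j)))"
    using assms(3,7) fin by (intro ballI linear_cong_poly_deg_le p) auto
  from bchoice[OF this] obtain h where H: "\<forall>j\<in>{1..r}. poly_deg_le (int p ^ v j - 1) (h j) \<and>
      (\<forall>a. (\<forall>i\<in>{1..n}. a i \<in> A i) \<longrightarrow>
        (int p dvd h j a \<longleftrightarrow> \<not> [(\<Sum>i=1..n. a i * x i j) = g j] (mod int p ^ v j)))" ..
  have h: "\<And>j. j \<in> {1..r} \<Longrightarrow> poly_deg_le (int p ^ v j - 1) (h j)"
    by (rule H[THEN bspec, THEN conjunct1])
  have hc: "\<And>j a. j \<in> {1..r} \<Longrightarrow> \<forall>i\<in>{1..n}. a i \<in> A i \<Longrightarrow>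
        int p dvd h j a \<longleftrightarrow> \<not> [(\<Sum>i=1..n. a i * x i j) = g j] (mod int p ^ v j)"
    by (rule H[THEN bspec, THEN conjunct2, THEN spec, THEN mp])
  define f where "f = (\<lambda>a. \<Prod>j=1..r. h j a)"
  have f: "poly_deg_le ?d f"
    unfolding f_def by (intro poly_deg_le_prod h)
  have sol: "(\<Otimes>\<^bsub>?G\<^esub>i\<in>{1..n}. x i [^]\<^bsub>?G\<^esub> a i) = g \<longleftrightarrow> \<not> int p dvd f a"
    if "a \<in> Pi\<^sub>E {1..n} A" for a
  proof -
    have "(\<Otimes>\<^bsub>?G\<^esub>i\<in>{1..n}. x i [^]\<^bsub>?G\<^esub> a i) = g
        \<longleftrightarrow> (\<forall>j\<in>{1..r}. [(\<Sum>i=1..n. a i * x i j) = g j] (mod int (p ^ v j)))"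
      using assms(5,8) p unfolding abelian_p_group_def by (intro finprod_eq_iff_cong) auto
    also have "\<dots> \<longleftrightarrow> (\<forall>j\<in>{1..r}. \<not> int p dvd h j a)"
      using hc[of _ a] that by (auto simp: PiE_iff)
    also have "\<dots> \<longleftrightarrow> \<not> int p dvd f a"
      using p by (simp add: f_def prime_dvd_prod_iff)
    finally show ?thesis .
  qed
  let ?S = "{a \<in> Pi\<^sub>E {1..n} A. \<not> int p dvd f a}"
  have num: "num_solutions ?G n A x g = card ?S"
    unfolding num_solutions_def by (intro arg_cong[of _ _ card] Collect_cong conj_cong refl sol)
  show ?thesis
  proof (cases "?S = {}")
    case True
    then have "card ?S = 0" by (simp only: card.empty)
    then show ?thesis unfolding num by (rule disjI1)
  next
    case False
    then obtain a where "a \<in> Pi\<^sub>E {1..n} A" "\<not> int p dvd f a" by blast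
    then have "min_dist n (\<lambda>i. card (A i)) (int (\<Sum>i=1..n. card (A i)) - ?d) \<le> card ?S"
      using p assms(7) fin by (intro card_nonvanishing_ge_min_dist f) auto
    then show ?thesis unfolding num by (rule disjI2)
  qed
qed

end
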